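(* Let $X\subsetneq\mathbb{P}^{n-1}$ be a projective variety and suppose that its vanishing (radical) ideal is minimally generated by homogeneous polynomials $f_1,\dots,f_p$ of degrees $d_1\le\cdots\le d_p$ respectively. Set $d=\mathrm{lcm}(d_1,\dots,d_p)$ and $N=\binom{n-1+d}{d}$. Let $r_1,\dots,r_p\in\mathbb{C}^N$ be the row vectors of coefficients of the polynomials $f_1^{d/d_1},\dots,f_p^{d/d_p}$, and let $C_X$ be a matrix whose rows form a basis of the vector space $\langle r_1,\dots,r_p\rangle\subseteq\mathbb{C}^N$. Then the Kalman variety $\mathcal{K}(X)$ is contained in the variety in $\mathbb{P}^{n^2-1}$ cut out by the maximal minors of the Kalman matrix $K_d(C_X)$.
   Context: Work over $\mathbb{C}$. A point $x=[v]\in\mathbb{P}^{n-1}$ is an eigenpoint of $A\in\mathbb{C}^{n\times n}$ if $v$ is an eigenvector of $A$. The Kalman variety of $X$ is $\mathcal{K}(X)=\{[A]\in\mathbb{P}^{n^2-1}=\mathbb{P}(\mathbb{C}^{n\times n})\mid\exists\,x\in X\text{ that is an eigenpoint of }A\}$. Let $A=(a_{ij})$ be an $n\times n$ matrix of variables and $\mathbb{C}[A]=\mathbb{C}[a_{ij}]$. Fix an ordering of the $N$ monomials of degree $d$ in $x_1,\dots,x_n$; coefficient vectors are taken with respect to it. The $d$th symmetric power $\rho_d(A)\in\mathbb{C}[A]^{N\times N}$ is the matrix whose row indexed by $x^\alpha$ consists of the coefficients, in the monomial basis, of $(Ax)^\alpha=\prod_i(a_{i1}x_1+\cdots+a_{in}x_n)^{\alpha_i}$.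 For $C\in\mathbb{C}^{q\times N}$ with $q\le N$, the Kalman matrix of order $d$ of $C$ is the matrix $K_d(C)$ with $q(N-q+1)$ rows and $N$ columns obtained by stacking the blocks $C,\ C\rho_d(A),\ C\rho_d(A)^2,\dots,C\rho_d(A)^{N-q}$. Its maximal minors are its $N\times N$ minors, which are polynomials in $\mathbb{C}[A]$. *)

theory Defs
  imports
    "HOL-Analysis.Analysis"
    "HOL-Library.Poly_Mapping"
    "Jordan_Normal_Form.Matrix"
    "Jordan_Normal_Form.Determinant"
    "Jordan_Normal_Form.VS_Connect"
    "Jordan_Normal_Form.DL_Submatrix"
begin

(* Points, and the matrices whose eigenvectors are taken, live in complex^'n and complex^'n^'n.
   Matrices whose size depends on d are those of Jordan_Normal_Form. *)
no_notation Matrix.vec_index (infixl \<open>$\<close> 100)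

subsection \<open>Polynomials\<close>

(* Exponent vectors are finitely supported functions, so for finite 'i this is exactly the
   polynomial ring over 'a in the indeterminates indexed by 'i. *)
type_synonym ('i, 'a) mpoly = "('i \<Rightarrow>\<^sub>0 nat) \<Rightarrow>\<^sub>0 'a"

definition Var :: "'i \<Rightarrow> ('i, 'a::comm_ring_1) mpoly"
  where "Var i = Poly_Mapping.single (Poly_Mapping.single i 1) 1"

definition Const :: "'a::comm_ring_1 \<Rightarrow> ('i, 'a) mpoly"
  where "Const c = Poly_Mapping.single 0 c"

definition mpoly_eval :: "('i::finite, 'a) mpoly \<Rightarrow> 'a ^ 'i \<Rightarrow> 'a::comm_ring_1"
  where "mpoly_eval f v =
    (\<Sum>m\<in>Poly_Mapping.keys f. Poly_Mapping.lookup f m * (\<Prod>i\<in>UNIV. (v $ i) ^ Poly_Mapping.lookup m i))"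

definition monomials_of_degree :: "nat \<Rightarrow> ('i::finite \<Rightarrow>\<^sub>0 nat) set"
  where "monomials_of_degree d = {m. (\<Sum>i\<in>UNIV. Poly_Mapping.lookup m i) = d}"

definition homogeneous :: "nat \<Rightarrow> ('i::finite, 'a::comm_ring_1) mpoly \<Rightarrow> bool"
  where "homogeneous d f \<longleftrightarrow> Poly_Mapping.keys f \<subseteq> monomials_of_degree d"

lemma card_monomials_of_degree:
  "card (monomials_of_degree d :: ('i::finite \<Rightarrow>\<^sub>0 nat) set) = (CARD('i) - 1 + d) choose d"
proof -
  obtain xs :: "'i list" where xs: "set xs = UNIV" "distinct xs"
    using finite_distinct_list finite by metis
  have len: "length xs = CARD('i)" using xs distinct_card by metis
  let ?h = "\<lambda>m::'i \<Rightarrow>\<^sub>0 nat. map (Poly_Mapping.lookup m) xs"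
  let ?L = "{l::nat list. length l = CARD('i) \<and> sum_list l = d}"
  have inj: "inj_on ?h (monomials_of_degree d)"
    using xs by (intro inj_onI poly_mapping_eqI) (simp add: map_eq_conv)
  have img: "?h ` monomials_of_degree d = ?L"
  proof (intro subset_antisym subsetI)
    fix l assume "l \<in> ?h ` monomials_of_degree d"
    then show "l \<in> ?L"
      using xs len by (auto simp: monomials_of_degree_def sum_list_distinct_conv_sum_set)
  next
    fix l assume l: "l \<in> ?L"
    define m :: "'i \<Rightarrow>\<^sub>0 nat" where "m = Abs_poly_mapping (\<lambda>i. the (map_of (zip xs l) i))"
    have lk: "Poly_Mapping.lookup m i = the (map_of (zip xs l) i)" for i
      unfolding m_def by (subst Abs_poly_mapping_inverse) auto
    have hm: "?h m = l"
      using l len xs by (intro nth_equalityI) (auto simp: lk map_of_zip_nth)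
    have "(\<Sum>i\<in>UNIV. Poly_Mapping.lookup m i) = sum_list (?h m)"
      using xs by (simp add: sum_list_distinct_conv_sum_set)
    then have "m \<in> monomials_of_degree d"
      using hm l by (simp add: monomials_of_degree_def)
    then show "l \<in> ?h ` monomials_of_degree d" using hm by force
  qed
  have "card (monomials_of_degree d :: ('i \<Rightarrow>\<^sub>0 nat) set) = card ?L"
    using card_image[OF inj] img by simp
  then show ?thesis
    by (simp add: card_length_sum_list add.commute Suc_leI)
qed

definition gen_ideal :: "'a::comm_ring_1 set \<Rightarrow> 'a set"
  where "gen_ideal S = Modules.module.span (*) S"

definition minimally_generates :: "'a::comm_ring_1 list \<Rightarrow> 'a set \<Rightarrow> bool"
  where "minimally_generates fs I \<longleftrightarrow>
    distinct fs \<and> gen_ideal (set fs) = I \<and> (\<forall>S. S \<subset> set fs \<longrightarrow> gen_ideal S \<noteq> I)"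

subsection \<open>Projective space\<close>

(* The point [v] is the line spanned by v; only nonzero v give points. *)
definition proj_pt :: "complex ^ 'i::finite \<Rightarrow> (complex ^ 'i) set"
  where "proj_pt v = vec.span {v}"

definition proj_space :: "(complex ^ 'i::finite) set set"
  where "proj_space = {proj_pt v | v. v \<noteq> 0}"

(* Vanishing is required at every representative, which for homogeneous polynomials is
   the same as vanishing at one of them. *)
definition proj_zeros :: "('i::finite, complex) mpoly set \<Rightarrow> (complex ^ 'i) set set"
  where "proj_zeros S = {x \<in> proj_space. \<forall>f\<in>S. \<forall>v. v \<noteq> 0 \<and> proj_pt v = x \<longrightarrow> mpoly_eval f v = 0}"

(* Not required to be irreducible. *)
definition projective_variety :: "(complex ^ 'i::finite) set set \<Rightarrow> bool"
  where "projective_variety X \<longleftrightarrow> (\<exists>S. (\<forall>f\<in>S. \<exists>e. homogeneous e f) \<and> X = proj_zeros S)"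

definition vanishing_ideal :: "(complex ^ 'i::finite) set set \<Rightarrow> ('i, complex) mpoly set"
  where "vanishing_ideal X = {f. \<forall>v. v \<noteq> 0 \<and> proj_pt v \<in> X \<longrightarrow> mpoly_eval f v = 0}"

subsection \<open>Kalman varieties\<close>

definition eigenpoint :: "complex ^ 'n ^ 'n \<Rightarrow> (complex ^ 'n::finite) set \<Rightarrow> bool"
  where "eigenpoint A x \<longleftrightarrow> (\<exists>v. v \<noteq> 0 \<and> x = proj_pt v \<and> (\<exists>c. A *v v = c *s v))"

(* Coordinate (i,j) of the space of matrices is the entry a_ij. *)
definition entries :: "complex ^ 'n ^ 'n \<Rightarrow> complex ^ ('n::finite \<times> 'n)"
  where "entries A = (\<chi> p. A $ fst p $ snd p)"

definition kalman_variety :: "(complex ^ 'n::finite) set set \<Rightarrow> (complex ^ ('n \<times> 'n)) set set"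
  where "kalman_variety X = {proj_pt (entries A) | A. A \<noteq> 0 \<and> (\<exists>x\<in>X. eigenpoint A x)}"

subsection \<open>Kalman matrices\<close>

(* Here ms is the chosen ordering of the monomials of degree d; it determines d. *)

definition coeff_vec :: "('i \<Rightarrow>\<^sub>0 nat) list \<Rightarrow> ('i, 'a::comm_ring_1) mpoly \<Rightarrow> 'a Matrix.vec"
  where "coeff_vec ms f = vec_of_list (map (Poly_Mapping.lookup f) ms)"

(* The linear form a_i1 x_1 + ... + a_in x_n, with coefficients in C[A]. *)
definition generic_row_form :: "'n::finite \<Rightarrow> ('n, ('n \<times> 'n, complex) mpoly) mpoly"
  where "generic_row_form i = (\<Sum>j\<in>UNIV. Const (Var (i, j)) * Var j)"

definition sym_power :: "('n::finite \<Rightarrow>\<^sub>0 nat) list \<Rightarrow> ('n \<times> 'n, complex) mpoly Matrix.mat"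
  where "sym_power ms = mat_of_rows (length ms)
    (map (\<lambda>\<alpha>. coeff_vec ms (\<Prod>i\<in>UNIV. generic_row_form i ^ Poly_Mapping.lookup \<alpha> i)) ms)"

definition kalman_matrix ::
  "('n::finite \<Rightarrow>\<^sub>0 nat) list \<Rightarrow> complex Matrix.mat \<Rightarrow> ('n \<times> 'n, complex) mpoly Matrix.mat"
  where "kalman_matrix ms C = mat_of_rows (dim_col C)
    (concat (map (\<lambda>k. Matrix.rows (map_mat Const C * (sym_power ms ^\<^sub>m k)))
      [0..<dim_col C - dim_row C + 1]))"

definition maximal_minors :: "'a::comm_ring_1 Matrix.mat \<Rightarrow> 'a set"
  where "maximal_minors M =
    {Determinant.det (submatrix M I UNIV) | I. I \<subseteq> {..<dim_row M} \<and> card I = dim_col M}"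

abbreviation vec_span :: "nat \<Rightarrow> complex Matrix.vec set \<Rightarrow> complex Matrix.vec set"
  where "vec_span N \<equiv> LinearCombinations.module.span class_ring (module_vec TYPE(complex) N)"

definition rows_form_basis :: "complex Matrix.mat \<Rightarrow> complex Matrix.vec set \<Rightarrow> bool"
  where "rows_form_basis C W \<longleftrightarrow>
    distinct (Matrix.rows C) \<and>
    \<not> LinearCombinations.module.lin_dep class_ring (module_vec TYPE(complex) (dim_col C)) (set (Matrix.rows C)) \<and>
    vec_span (dim_col C) (set (Matrix.rows C)) = W"

end

theory Submission
  imports Defs
begin

text \<open>
  Let $v$ span a point of $X$ with $A v = c v$. The vector $u$ of all monomials of degree $d$ in the
  coordinates of $v$ (the Veronese image of $v$) is a nonzero vector in the kernel of the Kalman matrix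
  evaluated at $A$, so every maximal minor vanishes at $A$.

  What puts $u$ into the kernel is that pairing the coefficients of a form of degree $d$ with $u$
  evaluates the form at $v$ (\<open>sum_coeffs_veronese\<close>). Applied to the rows of the symmetric
  power it says that \<open>\<rho>\<^sub>d(A)\<close> sends the Veronese image of $v$ to that of $A v$
  (\<open>sym_power_veronese\<close>), and so $u$ is an eigenvector of it, with eigenvalue $c^d$. Applied to
  the rows of $C$, which are combinations of the coefficient vectors of the powers of the $f_i$, it
  gives $C u = 0$. Hence each block satisfies
  \<open>C \<rho>\<^sub>d(A)\<^sup>k u = c\<^sup>d\<^sup>k C u = 0\<close>.

  The powers of the $f_i$ vanish at $v$ only if their exponents \<open>d / d\<^sub>i\<close> are positive. This is
  where minimality of the generators enters: none of them is zero, and a nonzero constant does not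
  vanish on the nonempty set $X$, so all the \<open>d\<^sub>i\<close> are positive.
\<close>

section \<open>Evaluation of polynomials\<close>

definition monomial_value :: "('i::finite \<Rightarrow>\<^sub>0 nat) \<Rightarrow> 'a ^ 'i \<Rightarrow> 'a::comm_ring_1"
  where "monomial_value m v = (\<Prod>i\<in>UNIV. (v $ i) ^ Poly_Mapping.lookup m i)"

lemma mpoly_eval_sum_superset:
  assumes "finite S" "Poly_Mapping.keys f \<subseteq> S"
  shows "mpoly_eval f v = (\<Sum>m\<in>S. Poly_Mapping.lookup f m * monomial_value m v)"
  unfolding mpoly_eval_def monomial_value_def
  using assms by (intro sum.mono_neutral_left) (auto simp: in_keys_iff)

lemma mpoly_eval_zero: "mpoly_eval 0 v = 0"
  by (simp add: mpoly_eval_def)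

lemma mpoly_eval_single: "mpoly_eval (Poly_Mapping.single m c) v = c * monomial_value m v"
  by (subst mpoly_eval_sum_superset[of "{m}"]) auto

lemma mpoly_eval_add: "mpoly_eval (f + g) v = mpoly_eval f v + mpoly_eval g v"
  unfolding mpoly_eval_def
  by (rule setsum_keys_plus_distrib) (simp_all add: algebra_simps)

lemma mpoly_induct [case_names zero single add]:
  fixes f :: "('i, 'a::comm_ring_1) mpoly"
  assumes "P 0" "\<And>m c. P (Poly_Mapping.single m c)" "\<And>f g. P f \<Longrightarrow> P g \<Longrightarrow> P (f + g)"
  shows "P f"
proof (induction f rule: update_induct)
  case const
  show ?case by (rule assms)
next
  case (update f a b)
  have "Poly_Mapping.update a b f = f + Poly_Mapping.single a b"
    using update(1)
    by (intro poly_mapping_eqI) (auto simp: lookup_update lookup_add lookup_single in_keys_iff when_def)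
  then show ?case using update assms by simp
qed

lemma monomial_value_add: "monomial_value (m + m') v = monomial_value m v * monomial_value m' v"
  by (simp add: monomial_value_def lookup_add power_add prod.distrib)

lemma mpoly_eval_mult: "mpoly_eval (f * g) v = mpoly_eval f v * mpoly_eval g v"
proof (induction f rule: mpoly_induct)
  case zero
  show ?case by (simp add: mpoly_eval_zero)
next
  case (single m c)
  show ?case
    by (induction g rule: mpoly_induct)
      (simp_all add: mpoly_eval_zero mpoly_eval_single mult_single monomial_value_add
        mpoly_eval_add algebra_simps)
next
  case (add f g)
  then show ?case by (simp add: mpoly_eval_add algebra_simps)
qed

lemma mpoly_eval_Const [simp]: "mpoly_eval (Const c) v = c"
  by (simp add: Const_def mpoly_eval_single monomial_value_def)

lemma mpoly_eval_Var [simp]: "mpoly_eval (Var i) v = v $ i"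
proof -
  have "(\<Prod>j\<in>UNIV. (v $ j) ^ Poly_Mapping.lookup (Poly_Mapping.single i 1) j) = (\<Prod>j\<in>UNIV. if j = i then v $ i else 1)"
    by (intro prod.cong) (auto simp: lookup_single when_def)
  then show ?thesis by (simp add: Var_def mpoly_eval_single monomial_value_def)
qed

interpretation mpoly_eval: comm_ring_hom "\<lambda>f. mpoly_eval f v" for v
proof
  show "mpoly_eval 1 v = 1"
    using mpoly_eval_Const[of 1 v] by (simp add: Const_def)
qed (simp_all add: mpoly_eval_zero mpoly_eval_add mpoly_eval_mult)

lemma homogeneous_zero: "homogeneous e 0"
  by (simp add: homogeneous_def)

lemma homogeneous_single:
  "m \<in> monomials_of_degree e \<Longrightarrow> homogeneous e (Poly_Mapping.single m c)"
  by (simp add: homogeneous_def)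

lemma homogeneous_add: "homogeneous e f \<Longrightarrow> homogeneous e g \<Longrightarrow> homogeneous e (f + g)"
  using keys_add[of f g] by (auto simp: homogeneous_def)

lemma homogeneous_sum: "(\<And>i. i \<in> I \<Longrightarrow> homogeneous e (f i)) \<Longrightarrow> homogeneous e (sum f I)"
  by (induction I rule: infinite_finite_induct) (auto intro: homogeneous_zero homogeneous_add)

lemma homogeneous_one: "homogeneous 0 1"
  by (simp add: homogeneous_def monomials_of_degree_def)

lemma homogeneous_mult:
  "homogeneous e f \<Longrightarrow> homogeneous e' g \<Longrightarrow> homogeneous (e + e') (f * g)"
  using keys_mult[of f g]
  by (fastforce simp: homogeneous_def monomials_of_degree_def lookup_add sum.distrib)

lemma homogeneous_power: "homogeneous e f \<Longrightarrow> homogeneous (k * e) (f ^ k)"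
  by (induction k) (auto intro: homogeneous_one homogeneous_mult)

lemma homogeneous_prod:
  "finite I \<Longrightarrow> (\<And>i. i \<in> I \<Longrightarrow> homogeneous (e i) (f i)) \<Longrightarrow> homogeneous (sum e I) (prod f I)"
  by (induction I rule: finite_induct) (auto intro: homogeneous_one homogeneous_mult)

section \<open>The Veronese map\<close>

definition veronese :: "('i::finite \<Rightarrow>\<^sub>0 nat) list \<Rightarrow> 'a ^ 'i \<Rightarrow> 'a::comm_ring_1 Matrix.vec"
  where "veronese ms v = vec_of_list (map (\<lambda>m. monomial_value m v) ms)"

lemma veronese_index [simp]:
  "j < length ms \<Longrightarrow> vec_index (veronese ms v) j = monomial_value (ms ! j) v"
  by (simp add: veronese_def vec_of_list_index)

lemma veronese_carrier [simp]: "veronese ms v \<in> carrier_vec (length ms)"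
  by (intro carrier_vecI) (simp add: veronese_def)

lemma dim_veronese [simp]: "dim_vec (veronese ms v) = length ms"
  by (simp add: veronese_def)

lemma coeff_vec_index:
  "j < length ms \<Longrightarrow> vec_index (coeff_vec ms f) j = Poly_Mapping.lookup f (ms ! j)"
  by (simp add: coeff_vec_def vec_of_list_index)

lemma dim_coeff_vec [simp]: "dim_vec (coeff_vec ms f) = length ms"
  by (simp add: coeff_vec_def)

lemma sum_coeffs_veronese:
  assumes "homogeneous d f" "distinct ms" "set ms = monomials_of_degree d"
  shows "(\<Sum>j<length ms. Poly_Mapping.lookup f (ms ! j) * monomial_value (ms ! j) v) = mpoly_eval f v"
proof -
  have "bij_betw (\<lambda>j. ms ! j) {..<length ms} (set ms)"
    using assms(2) by (intro bij_betw_nth) auto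
  then have "(\<Sum>j<length ms. Poly_Mapping.lookup f (ms ! j) * monomial_value (ms ! j) v)
      = (\<Sum>m\<in>set ms. Poly_Mapping.lookup f m * monomial_value m v)"
    by (rule sum.reindex_bij_betw)
  also have "\<dots> = mpoly_eval f v"
    using assms(1)
    by (intro mpoly_eval_sum_superset[symmetric]) (simp_all add: homogeneous_def flip: assms(3))
  finally show ?thesis .
qed

text \<open>
  This makes vanishing at $v$ a linear condition on coefficient vectors, which therefore passes to
  their linear combinations.
\<close>

lemma coeff_vec_veronese:
  assumes "homogeneous d f" "distinct ms" "set ms = monomials_of_degree d"
  shows "scalar_prod (coeff_vec ms f) (veronese ms v) = mpoly_eval f v"
  using sum_coeffs_veronese[OF assms]
  by (simp add: scalar_prod_def coeff_vec_index atLeast0LessThan)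

lemma veronese_scale:
  assumes "set ms \<subseteq> monomials_of_degree d"
  shows "veronese ms (c *s v) = c ^ d \<cdot>\<^sub>v veronese ms v"
proof (rule eq_vecI)
  fix j assume "j < dim_vec (c ^ d \<cdot>\<^sub>v veronese ms v)"
  then have j: "j < length ms" by simp
  then have "(\<Sum>i\<in>UNIV. Poly_Mapping.lookup (ms ! j) i) = d"
    using subsetD[OF assms nth_mem[OF j]] by (simp add: monomials_of_degree_def)
  then show "vec_index (veronese ms (c *s v)) j = vec_index (c ^ d \<cdot>\<^sub>v veronese ms v) j"
    using j by (simp add: monomial_value_def power_mult_distrib prod.distrib flip: power_sum)
qed simp

lemma veronese_nonzero:
  fixes v :: "'a::idom ^ 'i::finite"
  assumes "v \<noteq> 0" "set ms = monomials_of_degree d"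
  shows "veronese ms v \<noteq> 0\<^sub>v (length ms)"
proof -
  obtain i where i: "v $ i \<noteq> 0" using assms(1) by (auto simp: Finite_Cartesian_Product.vec_eq_iff)
  \<comment> \<open>The pure power of a nonzero coordinate is among the monomials.\<close>
  let ?m = "Poly_Mapping.single i d"
  have "?m \<in> set ms"
    unfolding assms(2) monomials_of_degree_def by (simp add: lookup_single when_def)
  then obtain j where j: "j < length ms" "ms ! j = ?m" by (auto simp: in_set_conv_nth)
  have "monomial_value ?m v \<noteq> 0"
    using i by (auto simp: monomial_value_def lookup_single when_def)
  then show ?thesis using j by (metis index_zero_vec(1) veronese_index)
qed

section \<open>Action of the symmetric power\<close>

lemma sym_power_carrier: "sym_power ms \<in> carrier_mat (length ms) (length ms)"
  by (simp add: sym_power_def mat_of_rows_def)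

lemma sym_power_index:
  "a < length ms \<Longrightarrow> b < length ms \<Longrightarrow> sym_power ms $$ (a, b) =
    Poly_Mapping.lookup (\<Prod>i\<in>UNIV. generic_row_form i ^ Poly_Mapping.lookup (ms ! a) i) (ms ! b)"
  by (simp add: sym_power_def mat_of_rows_def coeff_vec_index)

lemma homogeneous_generic_row_form: "homogeneous 1 (generic_row_form (i :: 'a::finite))"
  unfolding generic_row_form_def
proof (rule homogeneous_sum)
  fix j :: 'a
  have eq: "Const (Var (i, j) :: ('a \<times> 'a, complex) mpoly) * Var j =
      Poly_Mapping.single (Poly_Mapping.single j 1) (Var (i, j))"
    by (simp add: Const_def Var_def mult_single)
  have mem: "Poly_Mapping.single j 1 \<in> monomials_of_degree 1"
    by (simp add: monomials_of_degree_def lookup_single when_def)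
  show "homogeneous 1 (Const (Var (i, j) :: ('a \<times> 'a, complex) mpoly) * Var j)"
    unfolding eq by (rule homogeneous_single[OF mem])
qed

text \<open>
  The row indexed by \<open>x\<^sup>\<alpha>\<close> holds the coefficients of \<open>(A x)\<^sup>\<alpha>\<close>, so pairing it with the
  monomials of $v$ substitutes $v$ for $x$. The coefficients being polynomials in the entries of
  $A$, the substitution is carried out with $v$ regarded as a vector of constant polynomials, and
  only then is the generic matrix specialised to $A$.
\<close>

lemma sym_power_veronese:
  fixes A :: "complex ^ 'n::finite ^ 'n"
  assumes "distinct ms" "set ms = monomials_of_degree d"
  shows "map_mat (\<lambda>f. mpoly_eval f (entries A)) (sym_power ms) *\<^sub>v veronese ms v = veronese ms (A *v v)"
proof (rule eq_vecI)
  let ?ev = "\<lambda>f. mpoly_eval f (entries A)"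
  let ?cv = "\<chi> i. (Const (v $ i) :: ('n \<times> 'n, complex) mpoly)"
  let ?S = "map_mat ?ev (sym_power ms)"
  fix a assume "a < dim_vec (veronese ms (A *v v))"
  then have a: "a < length ms" by simp
  define F where "F = (\<Prod>i\<in>UNIV. generic_row_form i ^ Poly_Mapping.lookup (ms ! a) i)"
  have "homogeneous (\<Sum>i\<in>UNIV. Poly_Mapping.lookup (ms ! a) i * 1) F"
    unfolding F_def by (intro homogeneous_prod homogeneous_power homogeneous_generic_row_form) simp
  then have hom: "homogeneous d F"
    using nth_mem[OF a] assms(2) by (simp add: monomials_of_degree_def)
  have const: "?ev (monomial_value m ?cv) = monomial_value m v" for m
    by (simp add: monomial_value_def mpoly_eval.hom_prod mpoly_eval.hom_power)
  have form: "?ev (mpoly_eval (generic_row_form i) ?cv) = (A *v v) $ i" for i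
    by (simp add: generic_row_form_def mpoly_eval.hom_sum mpoly_eval_mult entries_def
        matrix_vector_mult_def)
  have "vec_index (?S *\<^sub>v veronese ms v) a =
      (\<Sum>b<length ms. ?ev (Poly_Mapping.lookup F (ms ! b)) * monomial_value (ms ! b) v)"
    using a sym_power_carrier[of ms]
    by (simp add: scalar_prod_def sym_power_index F_def atLeast0LessThan)
  also have "\<dots> = ?ev (\<Sum>b<length ms. Poly_Mapping.lookup F (ms ! b) * monomial_value (ms ! b) ?cv)"
    by (simp add: mpoly_eval.hom_sum mpoly_eval_mult const)
  also have "\<dots> = ?ev (mpoly_eval F ?cv)"
    using sum_coeffs_veronese[OF hom assms] by simp
  also have "\<dots> = monomial_value (ms ! a) (A *v v)"
    unfolding F_def monomial_value_def
    by (simp add: mpoly_eval.hom_prod mpoly_eval.hom_power form)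
  finally show "vec_index (?S *\<^sub>v veronese ms v) a = vec_index (veronese ms (A *v v)) a"
    using a by simp
qed (use sym_power_carrier[of ms] in simp)

section \<open>The kernel of the Kalman matrix\<close>

lemma pow_mat_eigenvector:
  fixes M :: "'a::field Matrix.mat"
  assumes "M \<in> carrier_mat n n" "u \<in> carrier_vec n" "M *\<^sub>v u = c \<cdot>\<^sub>v u"
  shows "(M ^\<^sub>m k) *\<^sub>v u = c ^ k \<cdot>\<^sub>v u"
proof (induction k)
  case 0
  show ?case using assms by (intro eq_vecI) auto
next
  case (Suc k)
  have "(M ^\<^sub>m Suc k) *\<^sub>v u = (M ^\<^sub>m k) *\<^sub>v (M *\<^sub>v u)"
    using assms by (simp add: assoc_mult_mat_vec[of _ n n _ n])
  also have "\<dots> = c \<cdot>\<^sub>v ((M ^\<^sub>m k) *\<^sub>v u)"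
    unfolding assms(3) by (rule mult_mat_vec[OF pow_carrier_mat[OF assms(1)] assms(2)])
  finally show ?case using Suc by (simp add: smult_smult_assoc)
qed

text \<open>
  Powers of the symmetric power only rescale the eigenvector $u$, so the equation $C u = 0$ of the
  first block propagates to every block.
\<close>

lemma kalman_matrix_kernel:
  fixes A :: "complex ^ 'n::finite ^ 'n"
  defines "ev \<equiv> (\<lambda>f. mpoly_eval f (entries A))"
  assumes u: "u \<in> carrier_vec (length ms)" and dim: "dim_col C = length ms"
    and C: "C *\<^sub>v u = 0\<^sub>v (dim_row C)"
    and eig: "map_mat ev (sym_power ms) *\<^sub>v u = c \<cdot>\<^sub>v u"
    and r: "r < dim_row (kalman_matrix ms C)"
  shows "(\<Sum>j<length ms. ev (kalman_matrix ms C $$ (r, j)) * vec_index u j) = 0"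
proof -
  interpret ev: comm_ring_hom ev
    unfolding ev_def by (rule mpoly_eval.comm_ring_hom_axioms)
  let ?n = "length ms" and ?S = "sym_power ms"
  let ?blocks = "concat (map (\<lambda>k. Matrix.rows (map_mat Const C * (?S ^\<^sub>m k)))
      [0..<dim_col C - dim_row C + 1])"
  have len: "r < length ?blocks" using r by (simp add: kalman_matrix_def)
  then have "?blocks ! r \<in> set ?blocks" by (rule nth_mem)
  then obtain k i where i: "i < dim_row C"
    and row: "?blocks ! r = Matrix.row (map_mat Const C * (?S ^\<^sub>m k)) i"
    by (auto simp: Matrix.rows_def)
  note S = sym_power_carrier[of ms]
  have C': "map_mat Const C \<in> carrier_mat (dim_row C) ?n" and Cc: "C \<in> carrier_mat (dim_row C) ?n"
    using dim by auto
  have evC: "map_mat ev (map_mat Const C) = C"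
    by (rule eq_matI) (simp_all add: ev_def)
  have evS: "map_mat ev ?S \<in> carrier_mat ?n ?n" using S by simp
  have "map_mat ev (map_mat Const C * (?S ^\<^sub>m k)) = C * (map_mat ev ?S ^\<^sub>m k)"
    using ev.mat_hom_mult[OF C' pow_carrier_mat[OF S]] by (simp add: evC ev.mat_hom_pow[OF S])
  also have "\<dots> *\<^sub>v u = C *\<^sub>v ((map_mat ev ?S ^\<^sub>m k) *\<^sub>v u)"
    by (rule assoc_mult_mat_vec[OF Cc pow_carrier_mat[OF evS] u])
  also have "\<dots> = C *\<^sub>v (c ^ k \<cdot>\<^sub>v u)"
    by (simp add: pow_mat_eigenvector[OF evS u eig])
  also have "\<dots> = 0\<^sub>v (dim_row C)"
    unfolding mult_mat_vec[OF Cc u] C by (rule eq_vecI) simp_all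
  finally have "vec_index (map_mat ev (map_mat Const C * (?S ^\<^sub>m k)) *\<^sub>v u) i = 0"
    using i by simp
  moreover have "vec_index (map_mat ev (map_mat Const C * (?S ^\<^sub>m k)) *\<^sub>v u) i =
      (\<Sum>j<?n. ev (vec_index (?blocks ! r) j) * vec_index u j)"
    unfolding row using i S u by (auto simp: scalar_prod_def atLeast0LessThan intro!: sum.cong)
  moreover have "kalman_matrix ms C $$ (r, j) = vec_index (?blocks ! r) j" if "j < ?n" for j
    unfolding kalman_matrix_def mat_of_rows_def using len that dim by simp
  ultimately show ?thesis by simp
qed

text \<open>
  Determinants commute with ring homomorphisms, so a minor can be specialised entry by entry; the
  resulting square matrix over a field is singular because $u$ lies in its kernel.
\<close>

lemma maximal_minor_vanishes:
  fixes h :: "'b::comm_ring_1 \<Rightarrow> 'a::field"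
  assumes "comm_ring_hom h"
    and u: "u \<in> carrier_vec (dim_col K)" "u \<noteq> 0\<^sub>v (dim_col K)"
    and ker: "\<And>r. r < dim_row K \<Longrightarrow> (\<Sum>j<dim_col K. h (K $$ (r, j)) * vec_index u j) = 0"
    and f: "f \<in> maximal_minors K"
  shows "h f = 0"
proof -
  interpret comm_ring_hom h by fact
  obtain I where I: "I \<subseteq> {..<dim_row K}" "card I = dim_col K"
    and f: "f = Determinant.det (submatrix K I UNIV)"
    using f by (auto simp: maximal_minors_def)
  let ?n = "dim_col K" and ?M = "map_mat h (submatrix K I UNIV)"
  have rows: "{i. i < dim_row K \<and> i \<in> I} = I" using I by auto
  have dims: "dim_row (submatrix K I UNIV) = ?n" "dim_col (submatrix K I UNIV) = ?n"
    unfolding dim_submatrix rows I(2) by simp_all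
  then have M: "?M \<in> carrier_mat ?n ?n" by (intro carrier_matI) simp_all
  have entry: "?M $$ (i, j) = h (K $$ (pick I i, j))" if "i < ?n" "j < ?n" for i j
  proof -
    have "submatrix K I UNIV $$ (i, j) = K $$ (pick I i, pick UNIV j)"
      using that dims by (intro submatrix_index) (simp_all only: dim_submatrix)
    then show ?thesis using that dims by (simp add: pick_UNIV)
  qed
  have "?M *\<^sub>v u = 0\<^sub>v ?n"
  proof (rule eq_vecI)
    fix i assume "i < dim_vec (0\<^sub>v ?n :: 'a Matrix.vec)"
    then have i: "i < ?n" by simp
    then have "pick I i < dim_row K" using I pick_in_set_le[of i I] by auto
    moreover have "vec_index (?M *\<^sub>v u) i = (\<Sum>j<?n. ?M $$ (i, j) * vec_index u j)"
      using i u(1) M by (simp add: scalar_prod_def atLeast0LessThan del: index_map_mat(1))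
    ultimately show "vec_index (?M *\<^sub>v u) i = vec_index (0\<^sub>v ?n) i"
      using i by (simp add: entry ker del: index_map_mat(1))
  qed (use M in simp)
  then have "Determinant.det ?M = 0"
    using det_0_iff_vec_prod_zero_field[OF M] u by blast
  then show ?thesis by (simp add: f hom_det)
qed

section \<open>Generators of the vanishing ideal\<close>

lemma module_over_itself: "Modules.module ((*) :: 'a::comm_ring_1 \<Rightarrow> 'a \<Rightarrow> 'a)"
  by unfold_locales (simp_all add: algebra_simps)

lemma minimally_generates_mem:
  "minimally_generates fs I \<Longrightarrow> f \<in> set fs \<Longrightarrow> f \<in> I"
  by (auto simp: minimally_generates_def gen_ideal_def intro: Modules.module.span_base[OF module_over_itself])

text \<open>Discarding a zero generator would leave the ideal unchanged.\<close>

lemma minimally_generates_nonzero: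
  assumes "minimally_generates fs I"
  shows "0 \<notin> set fs"
proof
  assume "0 \<in> set fs"
  moreover have "gen_ideal (set fs - {0}) = gen_ideal (set fs)"
    unfolding gen_ideal_def
    by (intro Modules.module.span_eq[OF module_over_itself, THEN iffD2])
      (auto intro: Modules.module.span_base[OF module_over_itself]
        Modules.module.span_zero[OF module_over_itself])
  ultimately show False using assms unfolding minimally_generates_def by blast
qed

lemma homogeneous_zero_degree_vanishing:
  assumes "homogeneous 0 f" "mpoly_eval f v = 0"
  shows "f = 0"
proof -
  have "(monomials_of_degree 0 :: ('a \<Rightarrow>\<^sub>0 nat) set) = {0}"
    by (auto simp: monomials_of_degree_def intro: poly_mapping_eqI)
  then have "Poly_Mapping.keys f \<subseteq> {0}" using assms(1) by (simp add: homogeneous_def)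
  moreover have "Poly_Mapping.lookup f 0 = 0"
    using mpoly_eval_sum_superset[OF _ calculation, of v] assms(2) by (simp add: monomial_value_def)
  ultimately show ?thesis by (metis keys_eq_empty subset_singletonD insertI1 in_keys_iff)
qed

text \<open>
  The orthogonal complements of a set and of its span agree. This is used twice: to pass from the
  given vectors to their span, and from that span to the basis of it formed by the rows.
\<close>

lemma annihilates_rows_of_basis:
  assumes basis: "rows_form_basis C (vec_span (dim_col C) R)"
    and R: "R \<subseteq> carrier_vec (dim_col C)" and u: "u \<in> carrier_vec (dim_col C)"
    and perp: "\<And>r. r \<in> R \<Longrightarrow> scalar_prod r u = 0"
  shows "C *\<^sub>v u = 0\<^sub>v (dim_row C)"
proof -
  interpret vec_space "TYPE(complex)" "dim_col C" .
  have rows: "set (Matrix.rows C) \<subseteq> carrier_vec (dim_col C)"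
    by (rule rows_carrier)
  have "u \<in> orthogonal_complement R"
    using R u perp by (auto simp: orthogonal_complement_def comm_scalar_prod[OF u] subsetD)
  then have "u \<in> orthogonal_complement (span (set (Matrix.rows C)))"
    using basis in_orthogonal_complement_span[OF R] by (simp add: rows_form_basis_def)
  then have "u \<in> orthogonal_complement (set (Matrix.rows C))"
    using in_orthogonal_complement_span[OF rows] by simp
  then have "scalar_prod u (Matrix.row C i) = 0" if "i < dim_row C" for i
    using that by (auto simp: orthogonal_complement_def Matrix.rows_def)
  then show ?thesis
    using u by (intro eq_vecI) (auto simp: comm_scalar_prod[OF _ u])
qed

section \<open>Kalman varieties\<close>

text \<open>
  Vanishing on projective space is tested at all representatives of a point. Any representative of
  $[A]$ is a multiple $t A$, and eigenvectors of $A$ are eigenvectors of $t A$, so it is enough to work with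
  one matrix at a time.
\<close>

lemma kalman_variety_representative:
  assumes "x \<in> kalman_variety X" "proj_pt w = x"
  obtains A v c where "w = entries A" "v \<noteq> 0" "proj_pt v \<in> X" "A *v v = c *s v"
proof -
  obtain A v c where A: "x = proj_pt (entries A)" and v: "v \<noteq> 0" "proj_pt v \<in> X" "A *v v = c *s v"
    using assms(1) by (auto simp: kalman_variety_def eigenpoint_def)
  have "w \<in> proj_pt w" unfolding proj_pt_def by (rule vec.span_base) simp
  then obtain t where t: "w = t *s entries A"
    using A assms(2) by (auto simp: proj_pt_def vec.span_singleton)
  define B where "B = (\<chi> i j. t * A $ i $ j)"
  have "w = entries B" by (simp add: t B_def entries_def Finite_Cartesian_Product.vec_eq_iff)
  moreover have "B *v v = (t * c) *s v"
  proof (subst Finite_Cartesian_Product.vec_eq_iff, intro allI)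
    fix i
    have "(B *v v) $ i = t * (A *v v) $ i"
      unfolding B_def matrix_vector_mult_def by (simp add: sum_distrib_left mult.assoc)
    then show "(B *v v) $ i = ((t * c) *s v) $ i"
      unfolding v(3) by (simp add: mult.assoc)
  qed
  ultimately show thesis using that[of B v "t * c"] v(1,2) by simp
qed

theorem proposition3p4:
  fixes X :: "(complex ^ 'n::finite) set set"
    and fs :: "('n, complex) mpoly list"
    and ds :: "nat list"
    and d N :: nat
    and ms :: "('n \<Rightarrow>\<^sub>0 nat) list"
    and C :: "complex Matrix.mat"
  assumes "projective_variety X" and "X \<subset> proj_space"
    and "minimally_generates fs (vanishing_ideal X)"
    and "length ds = length fs"
    and "\<And>i. i < length fs \<Longrightarrow> homogeneous (ds ! i) (fs ! i)"
    and "sorted ds"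
    and "d = Lcm (set ds)"
    and "N = (CARD('n) - 1 + d) choose d"
    and "distinct ms" and "set ms = monomials_of_degree d"
    and "dim_col C = N"
    and "rows_form_basis C
      (vec_span N {coeff_vec ms ((fs ! i) ^ (d div ds ! i)) | i. i < length fs})"
  shows "kalman_variety X \<subseteq> proj_zeros (maximal_minors (kalman_matrix ms C))"
proof
  fix x assume x: "x \<in> kalman_variety X"
  let ?K = "kalman_matrix ms C"
  have N: "length ms = N"
    using assms(8-10) distinct_card[of ms] card_monomials_of_degree[where 'i = 'n, of d] by simp
  have dimK: "dim_col ?K = length ms"
    using assms(11) N by (simp add: kalman_matrix_def)
  have "mpoly_eval f w = 0" if f: "f \<in> maximal_minors ?K" and w: "proj_pt w = x" for f w
  proof -
    obtain A v c where w: "w = entries A" and v: "v \<noteq> 0" "proj_pt v \<in> X" "A *v v = c *s v"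
      using kalman_variety_representative[OF x w] by blast
    let ?u = "veronese ms v"
    have root: "mpoly_eval (fs ! i) v = 0" if "i < length fs" for i
      using minimally_generates_mem[OF assms(3) nth_mem[OF that]] v by (simp add: vanishing_ideal_def)
    have "ds ! i \<noteq> 0" if i: "i < length fs" for i
    proof
      assume "ds ! i = 0"
      then have "fs ! i = 0"
        using homogeneous_zero_degree_vanishing[OF _ root[OF i]] assms(5)[OF i] by simp
      then show False using minimally_generates_nonzero[OF assms(3)] nth_mem[OF i] by simp
    qed
    then have "0 \<notin> set ds" using assms(4) by (auto simp: in_set_conv_nth)
    then have "d \<noteq> 0" unfolding assms(7) by (simp add: Lcm_0_iff)
    have vanish: "scalar_prod (coeff_vec ms ((fs ! i) ^ (d div ds ! i))) ?u = 0"
      if i: "i < length fs" for i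
    proof -
      have dvd: "ds ! i dvd d"
        unfolding assms(7) using i assms(4) by (intro dvd_Lcm) simp
      then have exp: "d div ds ! i > 0"
        using \<open>d \<noteq> 0\<close> by (simp add: dvd_div_eq_0_iff flip: neq0_conv)
      have "homogeneous d ((fs ! i) ^ (d div ds ! i))"
        using homogeneous_power[OF assms(5)[OF i], of "d div ds ! i"] dvd by simp
      then show ?thesis
        using exp root[OF i]
        by (simp add: coeff_vec_veronese[OF _ assms(9,10)] mpoly_eval.hom_power)
    qed
    have Cu: "C *\<^sub>v ?u = 0\<^sub>v (dim_row C)"
    proof (rule annihilates_rows_of_basis)
      show "rows_form_basis C (vec_span (dim_col C)
          {coeff_vec ms ((fs ! i) ^ (d div ds ! i)) | i. i < length fs})"
        using assms(11,12) by simp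
      show "{coeff_vec ms ((fs ! i) ^ (d div ds ! i)) | i. i < length fs} \<subseteq> carrier_vec (dim_col C)"
        using N assms(11) by (auto intro!: carrier_vecI)
      show "?u \<in> carrier_vec (dim_col C)"
        unfolding assms(11) N[symmetric] by (rule veronese_carrier)
    qed (use vanish in blast)
    have eig: "map_mat (\<lambda>f. mpoly_eval f (entries A)) (sym_power ms) *\<^sub>v ?u = c ^ d \<cdot>\<^sub>v ?u"
      using sym_power_veronese[OF assms(9,10), of A v] veronese_scale[of ms d c v] assms(10) v(3)
      by simp
    have dimC: "dim_col C = length ms" using assms(11) N by simp
    note ker = kalman_matrix_kernel[OF veronese_carrier dimC Cu eig]
    show ?thesis
      unfolding w
      by (rule maximal_minor_vanishes[where u = ?u and K = ?K])
        (use f ker veronese_nonzero[OF v(1) assms(10)] mpoly_eval.comm_ring_hom_axioms in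
          \<open>simp_all add: dimK\<close>)
  qed
  moreover have "x \<in> proj_space"
  proof -
    obtain A where A: "x = proj_pt (entries A)" "A \<noteq> 0"
      using x by (auto simp: kalman_variety_def)
    then have "entries A \<noteq> 0" by (auto simp: entries_def Finite_Cartesian_Product.vec_eq_iff)
    then show ?thesis using A by (auto simp: proj_space_def)
  qed
  ultimately show "x \<in> proj_zeros (maximal_minors ?K)"
    by (auto simp: proj_zeros_def)
qed

end
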